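(* Let $A_1,\dots,A_m\in\mathcal M_n(\mathbb C)$ be linearly independent and $V=(V_1,\dots,V_m)$ an $m$-tuple of complex $p\times q$ matrices. If $\|\rho_V^{(n)}(P_{\mathbf A})\|\le1$, then $\rho_V$ is contractive, i.e. $\|\rho_V(f)\|\le\|f\|_\infty$ for all $f\in\mathcal O(\Omega_{\mathbf A})$.
   Context: All norms of matrices are operator norms with respect to Euclidean norms. $\mathbf A=(A_1,\dots,A_m)$, $\Omega_{\mathbf A}=\{z\in\mathbb C^m:\|z_1A_1+\cdots+z_mA_m\|_{\rm op}<1\}$, $P_{\mathbf A}(z)=z_1A_1+\cdots+z_mA_m$. $\mathcal O(\Omega_{\mathbf A})$ is the algebra of functions holomorphic in a neighbourhood of $\overline{\Omega_{\mathbf A}}$, with $\|f\|_\infty=\sup_{\Omega_{\mathbf A}}|f|$. The homomorphism $\rho_V:\mathcal O(\Omega_{\mathbf A})\to\mathcal M_{p+q}(\mathbb C)$ (at the point $0$) is $$\rho_V(f)=\begin{pmatrix}f(0)I_p&\sum_{i=1}^m\partial_if(0)V_i\\0&f(0)I_q\end{pmatrix}.$$ For a matrix-valued function $F=(F_{ij})$ with entries in $\mathcal O(\Omega_{\mathbf A})$ and values in $\mathcal M_k(\mathbb C)$, $\rho_V^{(k)}(F)=(\rho_V(F_{ij}))_{i,j}$. *)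

theory Defs
  imports "HOL-Complex_Analysis.Complex_Analysis"
begin

text \<open>
  A \<open>p \<times> q\<close> complex matrix has type \<open>complex^'q^'p\<close> (rows indexed by \<open>'p\<close>, columns by \<open>'q\<close>);
  an \<open>m\<close>-tuple of matrices is a function on the index type \<open>'m\<close>.
\<close>

text \<open>The norm on \<open>complex^'n\<close> is the Euclidean one, so this is the operator norm
  with respect to Euclidean norms.\<close>

definition op_norm :: "complex^'c::finite^'r::finite \<Rightarrow> real" where
  "op_norm M = onorm ((*v) M)"

definition pencil :: "('m::finite \<Rightarrow> complex^'n^'k) \<Rightarrow> complex^'m \<Rightarrow> complex^'n^'k" where
  "pencil A z = (\<Sum>i\<in>UNIV. map_matrix ((*) (z $ i)) (A i))"

text \<open>Linear independence over \<open>\<complex>\<close> of the family, not merely of the set \<open>range A\<close>: repetitions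
  are excluded.\<close>

definition lin_indep_family :: "('m::finite \<Rightarrow> complex^'n^'k) \<Rightarrow> bool" where
  "lin_indep_family A \<longleftrightarrow>
     (\<forall>c. (\<Sum>i\<in>UNIV. map_matrix ((*) (c i)) (A i)) = 0 \<longrightarrow> (\<forall>i. c i = 0))"

definition Omega :: "('m::finite \<Rightarrow> complex^'n::finite^'n) \<Rightarrow> (complex^'m) set" where
  "Omega A = {z. op_norm (pencil A z) < 1}"

text \<open>Holomorphy in several variables: Frechet differentiability with a \<open>\<complex>\<close>-linear derivative
  (\<open>has_derivative\<close> by itself only provides an \<open>\<real>\<close>-linear one). Intended for open \<open>U\<close>.\<close>

definition holo_on :: "(complex^'m::finite \<Rightarrow> complex) \<Rightarrow> (complex^'m) set \<Rightarrow> bool" where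
  "holo_on f U \<longleftrightarrow>
     (\<forall>z\<in>U. \<exists>D. (f has_derivative D) (at z) \<and> Vector_Spaces.linear (*s) (*) D)"

text \<open>Functions holomorphic in a neighbourhood of the closure of \<open>W\<close>; these are total functions,
  with arbitrary values outside the neighbourhood.\<close>

definition holo_algebra :: "(complex^'m::finite) set \<Rightarrow> (complex^'m \<Rightarrow> complex) set" where
  "holo_algebra W = {f. \<exists>U. open U \<and> closure W \<subseteq> U \<and> holo_on f U}"

text \<open>The supremum is taken in \<open>real\<close>, hence meaningful when \<open>f\<close> is bounded on the nonempty set
  \<open>W\<close>; for \<open>f\<close> in \<^term>\<open>holo_algebra W\<close> this holds as soon as \<open>W\<close> is bounded, in particular for
  \<open>W = Omega A\<close> with \<open>A\<close> linearly independent.\<close>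

definition sup_norm_on :: "(complex^'m::finite) set \<Rightarrow> (complex^'m \<Rightarrow> complex) \<Rightarrow> real" where
  "sup_norm_on W f = (SUP z\<in>W. cmod (f z))"

definition partial_deriv :: "'m::finite \<Rightarrow> (complex^'m \<Rightarrow> complex) \<Rightarrow> complex^'m \<Rightarrow> complex" where
  "partial_deriv i f z = deriv (\<lambda>t. f (z + axis i t)) 0"

definition block_matrix ::
  "'a^'p^'p \<Rightarrow> 'a^'q^'p \<Rightarrow> 'a^'p^'q \<Rightarrow> 'a^'q^'q \<Rightarrow> 'a^('p + 'q)^('p + 'q)" where
  "block_matrix P Q R S = (\<chi> i j.
     case i of
       Inl a \<Rightarrow> (case j of Inl b \<Rightarrow> P $ a $ b | Inr b \<Rightarrow> Q $ a $ b)
     | Inr a \<Rightarrow> (case j of Inl b \<Rightarrow> R $ a $ b | Inr b \<Rightarrow> S $ a $ b))"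

definition rho ::
  "('m::finite \<Rightarrow> complex^'q::finite^'p::finite) \<Rightarrow> (complex^'m \<Rightarrow> complex) \<Rightarrow> complex^('p + 'q)^('p + 'q)"
  where
  "rho V f = block_matrix
     (mat (f 0)) (\<Sum>i\<in>UNIV. map_matrix ((*) (partial_deriv i f 0)) (V i))
     0           (mat (f 0))"

text \<open>The block matrix \<open>(rho V (F\<^sub>i\<^sub>j))\<^sub>i\<^sub>,\<^sub>j\<close>: an index \<open>(i, a)\<close> is position \<open>a\<close> inside block \<open>i\<close>.\<close>

definition rho_amp ::
  "('m::finite \<Rightarrow> complex^'q::finite^'p::finite) \<Rightarrow> (complex^'m \<Rightarrow> complex^'k^'k)
     \<Rightarrow> complex^('k \<times> ('p + 'q))^('k \<times> ('p + 'q))" where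
  "rho_amp V F = (\<chi> r s. rho V (\<lambda>z. F z $ fst r $ fst s) $ snd r $ snd s)"

end

theory Submission
  imports Defs
begin

text \<open>
  Let \<open>D = \<Sum>\<^sub>l \<partial>\<^sub>l f(0) V\<^sub>l\<close> be the corner of \<open>\<rho>\<^sub>V(f)\<close> and let \<open>|f| < M\<close> on the domain.
  The matrix \<open>\<rho>\<^sub>V(f)\<close> has norm at most \<open>M\<close> as soon as \<open>M \<parallel>D\<parallel> \<le> M\<^sup>2 - |f(0)|\<^sup>2\<close>. For vectors \<open>u\<close>, \<open>v\<close>
  put \<open>z\<^sub>l = \<langle>V\<^sub>l v, u\<rangle>\<close>. Then \<open>\<Sum>\<^sub>l z\<^sub>l A\<^sub>l\<close> is a compression of \<open>\<Sum>\<^sub>l A\<^sub>l \<otimes> V\<^sub>l\<close>, so the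
  hypothesis gives \<open>\<parallel>P\<^sub>A(z)\<parallel> \<le> \<parallel>u\<parallel> \<parallel>v\<parallel>\<close>, and the Schwarz--Pick inequality on the complex line through
  \<open>z\<close> bounds \<open>\<langle>D v, u\<rangle> = \<Sum>\<^sub>l \<partial>\<^sub>l f(0) z\<^sub>l\<close>. Linear independence is only used to make the domain
  bounded, so that the supremum of \<open>|f|\<close> is finite.
\<close>

no_notation fps_nth (infixl \<open>$\<close> 75)

section \<open>Euclidean norms and sums over composite index types\<close>

lemma norm_vec_power2: "(norm (x :: 'a::real_normed_vector^'n))\<^sup>2 = (\<Sum>i\<in>UNIV. (norm (x $ i))\<^sup>2)"
  by (simp add: norm_vec_def L2_set_def sum_nonneg)

lemma norm_vector_scalar_mult: "norm (t *s x) = norm t * norm (x :: 'a::real_normed_field^'n)"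
proof -
  have "(norm (t *s x))\<^sup>2 = (norm t * norm x)\<^sup>2"
    by (simp add: norm_vec_power2 power_mult_distrib norm_mult sum_distrib_left)
  then show ?thesis
    by simp
qed

lemma norm_le_sum_norm_nth: "norm (x :: 'a::real_normed_vector^'n) \<le> (\<Sum>i\<in>UNIV. norm (x $ i))"
  by (simp add: norm_vec_def L2_set_le_sum)

lemma cmod_sum_mult_power2_le:
  fixes f g :: "'a \<Rightarrow> complex"
  shows "(cmod (\<Sum>i\<in>I. f i * g i))\<^sup>2 \<le> (\<Sum>i\<in>I. (cmod (f i))\<^sup>2) * (\<Sum>i\<in>I. (cmod (g i))\<^sup>2)"
proof -
  have "cmod (\<Sum>i\<in>I. f i * g i) \<le> (\<Sum>i\<in>I. cmod (f i) * cmod (g i))"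
    by (rule order_trans[OF norm_sum]) (simp add: norm_mult)
  then have "(cmod (\<Sum>i\<in>I. f i * g i))\<^sup>2 \<le> (\<Sum>i\<in>I. cmod (f i) * cmod (g i))\<^sup>2"
    by (intro power_mono) auto
  also have "\<dots> \<le> (\<Sum>i\<in>I. (cmod (f i))\<^sup>2) * (\<Sum>i\<in>I. (cmod (g i))\<^sup>2)"
    by (rule Cauchy_Schwarz_ineq_sum)
  finally show ?thesis .
qed

lemma sum_UNIV_Plus:
  "(\<Sum>s\<in>(UNIV :: ('a::finite + 'b::finite) set). h s) = (\<Sum>a\<in>UNIV. h (Inl a)) + (\<Sum>b\<in>UNIV. h (Inr b))"
  for h :: "_ \<Rightarrow> 'c::comm_monoid_add"
  by (simp add: UNIV_Plus_UNIV[symmetric] sum.Plus del: UNIV_Plus_UNIV)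

lemma sum_UNIV_Times:
  "(\<Sum>s\<in>(UNIV :: ('a::finite \<times> 'b::finite) set). h s) = (\<Sum>a\<in>UNIV. \<Sum>b\<in>UNIV. h (a, b))"
  for h :: "_ \<Rightarrow> 'c::comm_monoid_add"
  by (simp add: UNIV_Times_UNIV[symmetric] sum.cartesian_product del: UNIV_Times_UNIV)

lemma norm_axis_one: "norm (axis j (1::complex)) = 1"
proof -
  have "(norm (axis j (1::complex)))\<^sup>2 = (\<Sum>i\<in>UNIV. if i = j then 1 else 0)"
    unfolding norm_vec_power2 by (intro sum.cong) (auto simp: axis_def)
  then show ?thesis
    by simp
qed

section \<open>Operator norms of matrices\<close>

lemma norm_matrix_vector_mult_le_op_norm: "norm (M *v x) \<le> op_norm M * norm x"
  unfolding op_norm_def by (rule onorm) simp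

lemma op_norm_leI: "(\<And>x. norm (M *v x) \<le> b * norm x) \<Longrightarrow> op_norm M \<le> b"
  unfolding op_norm_def by (rule onorm_le)

lemma op_norm_nonneg: "0 \<le> op_norm M"
  unfolding op_norm_def by (rule onorm_pos_le) simp

lemma norm_nth_le_op_norm: "norm (M $ i $ j) \<le> op_norm M"
proof -
  have "M $ i $ j = (M *v axis j 1) $ i"
    by (simp add: matrix_vector_mult_def axis_def if_distrib cong: if_cong)
  also have "norm \<dots> \<le> norm (M *v axis j 1)"
    by (simp add: Finite_Cartesian_Product.norm_nth_le)
  also have "\<dots> \<le> op_norm M"
    using norm_matrix_vector_mult_le_op_norm[of M "axis j 1"] by (simp add: norm_axis_one)
  finally show ?thesis .
qed

section \<open>The pencil and the boundedness of its unit ball\<close>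

lemma pencil_nth: "pencil A z $ i $ j = (\<Sum>l\<in>UNIV. z $ l * A l $ i $ j)"
  by (simp add: pencil_def)

lemma pencil_axis: "pencil A (axis l t) $ i $ j = t * A l $ i $ j"
proof -
  have "pencil A (axis l t) $ i $ j = (\<Sum>l'\<in>UNIV. if l' = l then t * A l $ i $ j else 0)"
    unfolding pencil_nth by (intro sum.cong) (auto simp: axis_def)
  then show ?thesis
    by simp
qed

lemma pencil_zero [simp]: "pencil A 0 = 0"
  by (simp add: vec_eq_iff pencil_nth)

lemma op_norm_zero [simp]: "op_norm (0 :: complex^'a::finite^'b::finite) = 0"
proof (rule order_antisym)
  show "op_norm (0 :: complex^'a^'b) \<le> 0"
    by (rule op_norm_leI) simp
qed (rule op_norm_nonneg)

lemma zero_in_Omega [simp]: "0 \<in> Omega A"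
  by (simp add: Omega_def)

lemma pencil_scale_vector: "pencil A (t *s z) *v k = t *s (pencil A z *v k)"
  by (simp add: vec_eq_iff matrix_vector_mult_def pencil_nth sum_distrib_left sum_distrib_right mult_ac)

lemma op_norm_pencil_scale_le: "op_norm (pencil A (t *s z)) \<le> cmod t * op_norm (pencil A z)"
proof (rule op_norm_leI)
  fix k
  show "norm (pencil A (t *s z) *v k) \<le> cmod t * op_norm (pencil A z) * norm k"
    unfolding pencil_scale_vector norm_vector_scalar_mult mult.assoc
    by (intro mult_left_mono norm_matrix_vector_mult_le_op_norm) auto
qed

text \<open>Linear independence says that the linear map \<open>pencil A\<close> is injective, hence
  bounded below in finite dimension. On the domain every entry of the pencil has modulus at most 1,
  so its Euclidean norm is at most the number \<open>N\<close> of entries.\<close>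

lemma bounded_Omega:
  fixes A :: "'m::finite \<Rightarrow> complex^'n::finite^'n"
  assumes "lin_indep_family A"
  shows "bounded (Omega A)"
proof -
  have lin: "linear (pencil A)"
    by (rule linearI)
       (simp_all add: vec_eq_iff pencil_nth sum.distrib ring_distribs scaleR_sum_right)
  have "inj (pencil A)"
  proof (subst linear_injective_0[OF lin], intro allI impI)
    fix z assume "pencil A z = 0"
    then have "\<forall>i. z $ i = 0"
      using assms unfolding lin_indep_family_def pencil_def by blast
    then show "z = 0"
      by (simp add: vec_eq_iff)
  qed
  then obtain B where B: "B > 0" "\<And>z. B * norm z \<le> norm (pencil A z)"
    using linear_inj_bounded_below_pos[OF lin] by blast
  define N where "N = (\<Sum>i\<in>(UNIV::'n set). \<Sum>j\<in>(UNIV::'n set). 1::real)"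
  have "norm z \<le> N / B" if "z \<in> Omega A" for z
  proof -
    have le1: "norm (pencil A z $ i $ j) \<le> 1" for i j
      using norm_nth_le_op_norm[of "pencil A z" i j] that by (simp add: Omega_def)
    have "B * norm z \<le> norm (pencil A z)"
      by (rule B)
    also have "\<dots> \<le> (\<Sum>i\<in>UNIV. norm (pencil A z $ i))"
      by (rule norm_le_sum_norm_nth)
    also have "\<dots> \<le> (\<Sum>i\<in>UNIV. \<Sum>j\<in>UNIV. norm (pencil A z $ i $ j))"
      by (intro sum_mono norm_le_sum_norm_nth)
    also have "\<dots> \<le> N"
      unfolding N_def by (intro sum_mono le1)
    finally show ?thesis
      using B(1) by (simp add: field_simps)
  qed
  then show ?thesis
    by (auto simp: bounded_iff)
qed

section \<open>The Schwarz-Pick inequality at the centre of the disc\<close>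

lemma Schwarz_Pick_0:
  assumes hol: "g holomorphic_on ball 0 1"
    and bound: "\<And>z. cmod z < 1 \<Longrightarrow> cmod (g z) < M"
  shows "M * cmod (deriv g 0) \<le> M\<^sup>2 - (cmod (g 0))\<^sup>2"
proof -
  have M: "0 < M"
    using order.strict_trans1[OF norm_ge_zero bound[of 0]] by simp
  define a where "a = g 0 / M"
  have a: "cmod a < 1"
    using bound[of 0] M by (simp add: a_def norm_divide)
  \<comment> \<open>Normalization: \<open>g / M\<close> maps the disc into itself, and the Moebius
    map sends \<open>a\<close>, its value at 0, to 0. The Schwarz lemma then bounds the derivative
    of \<open>h\<close> at 0 by 1.\<close>
  define h where "h = Moebius_function 0 a \<circ> (\<lambda>z. g z / M)"
  have img: "(\<lambda>z. g z / M) ` ball 0 1 \<subseteq> ball 0 1"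
    using bound M by (auto simp: norm_divide)
  have hol_h: "h holomorphic_on ball 0 1"
    unfolding h_def using img M
    by (intro holomorphic_on_compose_gen[OF _ Moebius_function_holomorphic[OF a]] holomorphic_intros hol)
       auto
  have h_less: "cmod (h z) < 1" if "cmod z < 1" for z
    unfolding h_def o_def using bound[OF that] M
    by (intro Moebius_function_norm_lt_1 a) (simp add: norm_divide)
  have g': "(g has_field_derivative deriv g 0) (at 0)"
    using hol by (intro holomorphic_derivI[of _ "ball 0 1"]) auto
  have sq: "cnj a * a = of_real ((cmod a)\<^sup>2)"
    by (simp only: complex_norm_square mult.commute)
  have sq1: "(cmod a)\<^sup>2 < 1"
    using a by (simp add: power_less_one_iff)
  have ne: "1 - cnj a * a \<noteq> 0"
    unfolding sq using sq1 by (metis less_irrefl of_real_1 of_real_eq_iff right_minus_eq)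
  have k': "((\<lambda>z. g z / M) has_field_derivative deriv g 0 / M) (at 0)"
    using M by (intro DERIV_cdivide g')
  \<comment> \<open>Quotient rule for the Moebius map. At 0 the numerator \<open>g 0 / M - a\<close>
    vanishes, so only one factor \<open>1 - cnj a * a\<close> survives in the denominator.\<close>
  have "((\<lambda>z. (g z / M - a) / (1 - cnj a * (g z / M))) has_field_derivative
      ((deriv g 0 / M - 0) * (1 - cnj a * (g 0 / M)) - (g 0 / M - a) * (0 - cnj a * (deriv g 0 / M)))
        / ((1 - cnj a * (g 0 / M)) * (1 - cnj a * (g 0 / M)))) (at 0)"
    using ne by (intro DERIV_divide DERIV_diff DERIV_cmult k' DERIV_const) (simp add: a_def)
  then have "(h has_field_derivative (deriv g 0 / M) / (1 - cnj a * a)) (at 0)"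
    unfolding h_def o_def Moebius_function_simple using ne by (simp add: a_def[symmetric])
  then have "deriv h 0 = (deriv g 0 / M) / (1 - cnj a * a)"
    by (rule DERIV_imp_deriv)
  moreover have "h 0 = 0"
    by (simp add: h_def a_def Moebius_function_eq_zero)
  then have "cmod (deriv h 0) \<le> 1"
    using Schwarz_Lemma(2)[OF hol_h _ h_less, of 0] by auto
  moreover have "1 - cnj a * a = of_real (1 - (cmod a)\<^sup>2)"
    by (simp add: sq)
  then have "cmod (1 - cnj a * a) = 1 - (cmod a)\<^sup>2"
    using sq1 by (simp only: norm_of_real)
  ultimately have "cmod (deriv g 0) / M / (1 - (cmod a)\<^sup>2) \<le> 1"
    using M by (simp add: norm_divide norm_mult)
  then have "cmod (deriv g 0) \<le> M * (1 - (cmod a)\<^sup>2)"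
    using sq1 M by (simp add: field_simps)
  then have "M * cmod (deriv g 0) \<le> M * (M * (1 - (cmod a)\<^sup>2))"
    using M by simp
  also have "\<dots> = M\<^sup>2 - (cmod (g 0))\<^sup>2"
    using M by (simp add: a_def norm_divide power_divide right_diff_distrib power2_eq_square)
  finally show ?thesis .
qed

section \<open>Restriction to complex lines\<close>

lemma holo_on_line_derivative:
  assumes "holo_on f U" "w + t *s z \<in> U"
  shows "\<exists>D. (f has_derivative D) (at (w + t *s z)) \<and> Vector_Spaces.linear (*s) (*) D \<and>
           ((\<lambda>t. f (w + t *s z)) has_field_derivative D z) (at t)"
proof -
  obtain D where D: "(f has_derivative D) (at (w + t *s z))" "Vector_Spaces.linear (*s) (*) D"
    using assms unfolding holo_on_def by blast
  have "linear (\<lambda>t::complex. t *s z)"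
    by (rule linearI) (simp_all add: vec_eq_iff algebra_simps)
  then have "bounded_linear (\<lambda>t::complex. t *s z)"
    by (simp add: linear_conv_bounded_linear)
  then have "((\<lambda>t. w + t *s z) has_derivative (\<lambda>t. t *s z)) (at t)"
    by (auto intro!: derivative_eq_intros bounded_linear_imp_has_derivative)
  then have "((\<lambda>t. f (w + t *s z)) has_derivative (\<lambda>t. D (t *s z))) (at t)"
    using D(1) by (rule has_derivative_compose)
  moreover have "D (t *s z) = D z * t" for t
    using D(2) by (simp add: Vector_Spaces.linear_iff mult.commute)
  ultimately show ?thesis
    using D unfolding has_field_derivative_def by auto
qed

text \<open>The derivative along any line through 0 is the Frechet derivative applied to the
  direction. Its complex linearity allows expansion of the direction in the standard basis, whose
  lines give the partial derivatives.\<close>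

lemma deriv_line_eq_sum_partial_deriv:
  assumes "holo_on f U" "0 \<in> U"
  shows "deriv (\<lambda>t. f (t *s z)) 0 = (\<Sum>i\<in>UNIV. partial_deriv i f 0 * z $ i)"
proof -
  obtain D where D: "(f has_derivative D) (at 0)" "Vector_Spaces.linear (*s) (*) D"
    using assms unfolding holo_on_def by blast
  have dv: "deriv (\<lambda>t. f (t *s x)) 0 = D x" for x
  proof -
    have "0 + 0 *s x \<in> U"
      using assms(2) by simp
    \<comment> \<open>The line lemma yields its own derivative \<open>D'\<close>; uniqueness
      identifies it with the fixed \<open>D\<close>.\<close>
    from holo_on_line_derivative[OF assms(1) this] obtain D'
      where D': "(f has_derivative D') (at 0)" "((\<lambda>t. f (t *s x)) has_field_derivative D' x) (at 0)"
      by auto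
    then show ?thesis
      using DERIV_imp_deriv has_derivative_unique[OF D(1) D'(1)] by blast
  qed
  have pd: "partial_deriv i f 0 = D (axis i 1)" for i
  proof -
    have "(\<lambda>t::complex. axis i t) = (\<lambda>t. t *s axis i 1)"
      by (auto simp: fun_eq_iff vec_eq_iff axis_def)
    then show ?thesis
      using dv[of "axis i 1"] unfolding partial_deriv_def add_0 by metis
  qed
  interpret Vector_Spaces.linear "(*s)" "(*)" D by (rule D(2))
  have "D z = D (\<Sum>i\<in>UNIV. z $ i *s axis i 1)"
    by (simp add: basis_expansion)
  also have "\<dots> = (\<Sum>i\<in>UNIV. D (axis i 1) * z $ i)"
    by (simp add: sum scale mult.commute)
  finally show ?thesis
    by (simp add: dv pd)
qed

text \<open>Dividing \<open>z\<close> by \<open>r\<close> gives a direction \<open>y\<close> whose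
  open unit disc of multiples lies in the domain, so Schwarz-Pick applies to \<open>f\<close> on
  that disc; undoing the scaling gives the factor \<open>r\<close>. Taking any positive upper bound
  \<open>r\<close> avoids division by zero when the pencil vanishes at \<open>z\<close>.\<close>

lemma sum_partial_deriv_bound:
  assumes holo: "holo_on f U" and U: "Omega A \<subseteq> U"
    and bound: "\<And>z. z \<in> Omega A \<Longrightarrow> cmod (f z) < M"
    and z: "op_norm (pencil A z) \<le> r" and r: "0 < r"
  shows "M * cmod (\<Sum>i\<in>UNIV. partial_deriv i f 0 * z $ i) \<le> (M\<^sup>2 - (cmod (f 0))\<^sup>2) * r"
proof -
  define y where "y = inverse (of_real r) *s z"
  have "op_norm (pencil A y) \<le> inverse r * op_norm (pencil A z)"
    using op_norm_pencil_scale_le[of A "inverse (of_real r)" z] r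
    by (simp add: y_def norm_inverse)
  also have "\<dots> \<le> inverse r * r"
    using z r by (intro mult_left_mono) auto
  finally have y: "op_norm (pencil A y) \<le> 1"
    using r by simp
  have in_Omega: "t *s y \<in> Omega A" if "cmod t < 1" for t
  proof -
    have "op_norm (pencil A (t *s y)) \<le> cmod t * op_norm (pencil A y)"
      by (rule op_norm_pencil_scale_le)
    also have "\<dots> \<le> cmod t"
      using y by (simp add: mult_left_le)
    finally show ?thesis
      using that by (simp add: Omega_def)
  qed
  have "(\<lambda>t. f (t *s y)) field_differentiable at t" if "cmod t < 1" for t
    using holo_on_line_derivative[OF holo, of 0 t y] in_Omega[OF that] U
    unfolding field_differentiable_def by auto
  then have "(\<lambda>t. f (t *s y)) holomorphic_on ball 0 1"
    by (auto simp: holomorphic_on_def field_differentiable_at_within)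
  from Schwarz_Pick_0[OF this, of M]
  have "M * cmod (deriv (\<lambda>t. f (t *s y)) 0) \<le> M\<^sup>2 - (cmod (f 0))\<^sup>2"
    using bound in_Omega by simp
  also have "deriv (\<lambda>t. f (t *s y)) 0 = (\<Sum>i\<in>UNIV. partial_deriv i f 0 * z $ i) / of_real r"
    using deriv_line_eq_sum_partial_deriv[OF holo, of y] U zero_in_Omega[of A]
    by (simp add: y_def sum_distrib_left divide_inverse mult_ac subset_iff)
  finally show ?thesis
    using r by (simp add: norm_divide field_simps)
qed

section \<open>The amplified pencil and its compressions\<close>

lemma rho_pencil_nth_Inr:
  "rho V (\<lambda>z. pencil A z $ i $ j) $ Inl a $ Inr b = (\<Sum>l\<in>UNIV. A l $ i $ j * V l $ a $ b)"
proof -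
  have "partial_deriv l (\<lambda>z. pencil A z $ i $ j) 0 = A l $ i $ j" for l
  proof -
    have "((\<lambda>t. t * A l $ i $ j) has_field_derivative A l $ i $ j) (at 0)"
      by (auto intro!: derivative_eq_intros)
    then show ?thesis
      by (simp add: partial_deriv_def pencil_axis DERIV_imp_deriv)
  qed
  then show ?thesis
    by (simp add: rho_def block_matrix_def)
qed

text \<open>Apply \<open>rho_amp V (pencil A)\<close> to the tensor product of \<open>k\<close> and
  \<open>v\<close>, then contract the \<open>'p\<close> index against \<open>u\<close>: the result
  is the pencil at the given point applied to \<open>k\<close>. Contraction costs at most
  \<open>norm u\<close>, by Cauchy-Schwarz.\<close>

lemma op_norm_pencil_compression_le:
  fixes A :: "'m::finite \<Rightarrow> complex^'n::finite^'n"
    and V :: "'m \<Rightarrow> complex^'q::finite^'p::finite"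
  shows "op_norm (pencil A (\<chi> l. \<Sum>a\<in>UNIV. (V l *v v) $ a * cnj (u $ a)))
           \<le> op_norm (rho_amp V (pencil A)) * (norm u * norm v)"
proof (rule op_norm_leI)
  fix k :: "complex^'n"
  let ?z = "\<chi> l. \<Sum>a\<in>UNIV. (V l *v v) $ a * cnj (u $ a)"
  let ?T = "rho_amp V (pencil A)"
  \<comment> \<open>The tensor of \<open>k\<close> and \<open>v\<close> sits in the
    \<open>Inr\<close> coordinates, with zeros elsewhere, so the rows \<open>(i, Inl a)\<close> of
    the image see only the corner blocks.\<close>
  define X :: "complex^('n \<times> ('p + 'q))"
    where "X = (\<chi> s. case snd s of Inl a \<Rightarrow> 0 | Inr b \<Rightarrow> k $ fst s * v $ b)"
  have X: "norm X = norm k * norm v"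
  proof -
    have "(norm X)\<^sup>2 = (norm k * norm v)\<^sup>2"
      by (simp add: norm_vec_power2 X_def sum_UNIV_Times sum_UNIV_Plus norm_mult power_mult_distrib sum_product)
    then show ?thesis
      by simp
  qed
  have TX: "(?T *v X) $ (i, Inl a)
      = (\<Sum>j\<in>UNIV. \<Sum>b\<in>UNIV. (\<Sum>l\<in>UNIV. A l $ i $ j * V l $ a $ b) * (k $ j * v $ b))" for i a
    by (simp add: matrix_vector_mult_def X_def rho_amp_def sum_UNIV_Times sum_UNIV_Plus rho_pencil_nth_Inr)
  have Pk: "(pencil A ?z *v k) $ i = (\<Sum>a\<in>UNIV. (?T *v X) $ (i, Inl a) * cnj (u $ a))" for i
  proof -
    have "(pencil A ?z *v k) $ i
        = (\<Sum>j\<in>UNIV. \<Sum>l\<in>UNIV. \<Sum>a\<in>UNIV. \<Sum>b\<in>UNIV.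
             A l $ i $ j * V l $ a $ b * (k $ j * v $ b) * cnj (u $ a))"
      by (simp add: matrix_vector_mult_def pencil_nth sum_distrib_left sum_distrib_right mult_ac)
    also have "\<dots> = (\<Sum>j\<in>UNIV. \<Sum>a\<in>UNIV. \<Sum>l\<in>UNIV. \<Sum>b\<in>UNIV.
             A l $ i $ j * V l $ a $ b * (k $ j * v $ b) * cnj (u $ a))"
      by (intro sum.cong refl sum.swap)
    also have "\<dots> = (\<Sum>a\<in>UNIV. \<Sum>j\<in>UNIV. \<Sum>l\<in>UNIV. \<Sum>b\<in>UNIV.
             A l $ i $ j * V l $ a $ b * (k $ j * v $ b) * cnj (u $ a))"
      by (rule sum.swap)
    also have "\<dots> = (\<Sum>a\<in>UNIV. \<Sum>j\<in>UNIV. \<Sum>b\<in>UNIV. \<Sum>l\<in>UNIV.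
             A l $ i $ j * V l $ a $ b * (k $ j * v $ b) * cnj (u $ a))"
      by (intro sum.cong refl sum.swap)
    also have "\<dots> = (\<Sum>a\<in>UNIV. (?T *v X) $ (i, Inl a) * cnj (u $ a))"
      by (simp add: TX sum_distrib_right)
    finally show ?thesis .
  qed
  have "(norm (pencil A ?z *v k))\<^sup>2 = (\<Sum>i\<in>UNIV. (cmod (\<Sum>a\<in>UNIV. (?T *v X) $ (i, Inl a) * cnj (u $ a)))\<^sup>2)"
    by (simp add: norm_vec_power2 Pk)
  \<comment> \<open>Cauchy-Schwarz in \<open>a\<close>, separately for each
    \<open>i\<close>.\<close>
  also have "\<dots> \<le> (\<Sum>i\<in>UNIV. (\<Sum>a\<in>UNIV. (cmod ((?T *v X) $ (i, Inl a)))\<^sup>2) * (norm u)\<^sup>2)"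
    using cmod_sum_mult_power2_le[where g = "\<lambda>a. cnj (u $ a)" and I = UNIV]
    by (intro sum_mono) (simp add: norm_vec_power2)
  \<comment> \<open>The missing rows \<open>(i, Inr b)\<close> can only increase the norm.\<close>
  also have "\<dots> \<le> (norm (?T *v X))\<^sup>2 * (norm u)\<^sup>2"
    unfolding sum_distrib_right[symmetric]
    by (intro mult_right_mono)
       (simp_all add: norm_vec_power2[of "?T *v X"] sum_UNIV_Times sum_UNIV_Plus sum_mono sum_nonneg)
  finally have "norm (pencil A ?z *v k) \<le> norm (?T *v X) * norm u"
    by (simp add: power_mult_distrib[symmetric])
  also have "\<dots> \<le> op_norm ?T * norm X * norm u"
    by (intro mult_right_mono norm_matrix_vector_mult_le_op_norm) auto
  finally show "norm (pencil A ?z *v k) \<le> op_norm ?T * (norm u * norm v) * norm k"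
    by (simp add: X mult_ac)
qed

section \<open>Norm estimates for the corner and for the triangular block matrix\<close>

lemma op_norm_le_of_sesquilinear_bound:
  fixes D :: "complex^'q::finite^'p::finite"
  assumes "\<And>u v. u \<noteq> 0 \<Longrightarrow> v \<noteq> 0 \<Longrightarrow>
      cmod (\<Sum>a\<in>UNIV. (D *v v) $ a * cnj (u $ a)) \<le> d * (norm u * norm v)"
    and d: "0 \<le> d"
  shows "op_norm D \<le> d"
proof (rule op_norm_leI)
  fix v
  show "norm (D *v v) \<le> d * norm v"
  proof (cases "v = 0 \<or> D *v v = 0")
    case True
    then show ?thesis
      using d by auto
  next
    case False
    \<comment> \<open>The test vector \<open>u = D *v v\<close> turns the form into a squared norm,
      and one factor \<open>norm (D *v v)\<close> cancels.\<close>
    have "(\<Sum>a\<in>UNIV. (D *v v) $ a * cnj ((D *v v) $ a)) = of_real ((norm (D *v v))\<^sup>2)"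
      by (simp only: norm_vec_power2 of_real_sum complex_norm_square)
    then have "(norm (D *v v))\<^sup>2 \<le> d * (norm (D *v v) * norm v)"
      using assms(1)[of "D *v v" v] False by (simp add: norm_power)
    then show ?thesis
      using False by (simp add: power2_eq_square mult_ac)
  qed
qed

text \<open>The triangle inequality reduces the claim to the real 2 by 2 upper triangular matrix
  with diagonal \<open>cmod c\<close> and corner \<open>d\<close>. The value of \<open>d\<close> is
  the largest corner norm that the hypothesis allows, and for it the 2 by 2 matrix has norm exactly
  \<open>M\<close>.\<close>

lemma op_norm_scalar_upper_block_le:
  fixes D :: "complex^'q::finite^'p::finite"
  assumes M: "0 < M" and D: "M * op_norm D \<le> M\<^sup>2 - (cmod c)\<^sup>2"
  shows "op_norm (block_matrix (mat c) D 0 (mat c)) \<le> M"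
proof (rule op_norm_leI)
  fix x :: "complex^('p + 'q)"
  let ?B = "block_matrix (mat c) D 0 (mat c)"
  define u :: "complex^'p" where "u = (\<chi> a. x $ Inl a)"
  define v :: "complex^'q" where "v = (\<chi> b. x $ Inr b)"
  define d where "d = (M\<^sup>2 - (cmod c)\<^sup>2) / M"
  have Dd: "op_norm D \<le> d"
    using D M by (simp add: d_def field_simps)
  have d0: "0 \<le> d"
    using Dd op_norm_nonneg[of D] by linarith
  have x: "(norm x)\<^sup>2 = (norm u)\<^sup>2 + (norm v)\<^sup>2"
    by (simp add: norm_vec_power2 u_def v_def sum_UNIV_Plus)
  have mat: "(\<Sum>j\<in>UNIV. mat c $ i $ j * y j) = c * y i" for i :: "'i::finite" and y :: "'i \<Rightarrow> complex"
  proof -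
    have "(\<Sum>j\<in>UNIV. mat c $ i $ j * y j) = (\<Sum>j\<in>UNIV. if i = j then c * y j else 0)"
      by (intro sum.cong) (auto simp: mat_def)
    then show ?thesis
      by simp
  qed
  have "(norm (?B *v x))\<^sup>2 = (norm (c *s u + D *v v))\<^sup>2 + (norm (c *s v))\<^sup>2"
    by (simp add: norm_vec_power2 matrix_vector_mult_def block_matrix_def sum_UNIV_Plus mat u_def v_def)
  also have "\<dots> \<le> (cmod c * norm u + d * norm v)\<^sup>2 + (cmod c * norm v)\<^sup>2"
  proof (intro add_mono power_mono)
    have "norm (D *v v) \<le> op_norm D * norm v"
      by (rule norm_matrix_vector_mult_le_op_norm)
    also have "\<dots> \<le> d * norm v"
      using Dd by (simp add: mult_right_mono)
    finally show "norm (c *s u + D *v v) \<le> cmod c * norm u + d * norm v"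
      by (metis add_left_mono norm_triangle_ineq norm_vector_scalar_mult order_trans)
  qed (simp_all add: norm_vector_scalar_mult)
  also have "\<dots> \<le> M\<^sup>2 * ((norm u)\<^sup>2 + (norm v)\<^sup>2)"
  proof -
    have "M * d = M\<^sup>2 - (cmod c)\<^sup>2"
      using M by (simp add: d_def)
    \<comment> \<open>With \<open>M * d\<close> known, the deficit is a nonnegative multiple of a
      perfect square.\<close>
    then have "M * (M\<^sup>2 * ((norm u)\<^sup>2 + (norm v)\<^sup>2)
                - ((cmod c * norm u + d * norm v)\<^sup>2 + (cmod c * norm v)\<^sup>2))
        = d * (M * norm u - cmod c * norm v)\<^sup>2"
      by algebra
    moreover have "0 \<le> d * (M * norm u - cmod c * norm v)\<^sup>2"
      using d0 by simp
    ultimately show ?thesis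
      using M by (metis diff_ge_0_iff_ge zero_le_mult_iff not_less)
  qed
  finally have "(norm (?B *v x))\<^sup>2 \<le> (M * norm x)\<^sup>2"
    by (simp add: x power_mult_distrib)
  then show "norm (?B *v x) \<le> M * norm x"
    by (rule power2_le_imp_le) (use M in simp)
qed

theorem corollary1p3:
  fixes A :: "'m::finite \<Rightarrow> complex^'n::finite^'n"
    and V :: "'m \<Rightarrow> complex^'q::finite^'p::finite"
  assumes "lin_indep_family A"
    and "op_norm (rho_amp V (pencil A)) \<le> 1"
  shows "\<forall>f \<in> holo_algebra (Omega A). op_norm (rho V f) \<le> sup_norm_on (Omega A) f"
proof
  fix f assume "f \<in> holo_algebra (Omega A)"
  then obtain U where U: "closure (Omega A) \<subseteq> U" and holo: "holo_on f U"
    by (auto simp: holo_algebra_def)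
  have sub: "Omega A \<subseteq> U"
    using U closure_subset by blast
  \<comment> \<open>Boundedness of \<open>f\<close> on the compact closure makes the real supremum a
    genuine upper bound.\<close>
  have "continuous_on (closure (Omega A)) f"
    using holo U unfolding holo_on_def
    by (meson continuous_at_imp_continuous_on has_derivative_continuous subsetD)
  moreover have "compact (closure (Omega A))"
    using bounded_Omega[OF assms(1)] by (simp add: compact_closure)
  ultimately have "bounded (f ` closure (Omega A))"
    by (intro compact_imp_bounded compact_continuous_image)
  then have bdd: "bdd_above ((\<lambda>z. cmod (f z)) ` Omega A)"
    using closure_subset[of "Omega A"] by (auto simp: bounded_iff bdd_above_def)
  have sup: "cmod (f z) \<le> sup_norm_on (Omega A) f" if "z \<in> Omega A" for z
    unfolding sup_norm_on_def by (rule cSUP_upper[OF that bdd])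
  let ?D = "\<Sum>i\<in>UNIV. map_matrix ((*) (partial_deriv i f 0)) (V i)"
  show "op_norm (rho V f) \<le> sup_norm_on (Omega A) f"
  \<comment> \<open>Schwarz-Pick needs the strict bound \<open>cmod (f z) < M\<close>, so the
    estimate is proved for every \<open>M\<close> above the supremum.\<close>
  proof (rule dense_ge)
    fix M assume "sup_norm_on (Omega A) f < M"
    then have bound: "cmod (f z) < M" if "z \<in> Omega A" for z
      using sup[OF that] by simp
    have f0: "cmod (f 0) < M"
      by (rule bound) simp
    then have M: "0 < M"
      using norm_ge_zero[of "f 0"] by linarith
    have "(cmod (f 0))\<^sup>2 \<le> M\<^sup>2"
      using f0 by (intro power_mono) auto
    then have nonneg: "0 \<le> (M\<^sup>2 - (cmod (f 0))\<^sup>2) / M"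
      using M by simp
    have "op_norm ?D \<le> (M\<^sup>2 - (cmod (f 0))\<^sup>2) / M"
    proof (rule op_norm_le_of_sesquilinear_bound[OF _ nonneg])
      fix u :: "complex^'p" and v :: "complex^'q"
      assume "u \<noteq> 0" "v \<noteq> 0"
      then have r: "0 < norm u * norm v"
        by simp
      let ?z = "\<chi> l. \<Sum>a\<in>UNIV. (V l *v v) $ a * cnj (u $ a)"
      have "op_norm (pencil A ?z) \<le> op_norm (rho_amp V (pencil A)) * (norm u * norm v)"
        by (rule op_norm_pencil_compression_le)
      also have "\<dots> \<le> norm u * norm v"
        using mult_right_mono[OF assms(2), of "norm u * norm v"] r by simp
      finally have z: "op_norm (pencil A ?z) \<le> norm u * norm v" .
      \<comment> \<open>Pairing the corner with \<open>u\<close> and \<open>v\<close> is the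
        derivative of \<open>f\<close> at 0 in the direction \<open>?z\<close>, which converts the
        line estimate into a bound for the corner.\<close>
      have "(\<Sum>a\<in>UNIV. (?D *v v) $ a * cnj (u $ a)) = (\<Sum>l\<in>UNIV. partial_deriv l f 0 * ?z $ l)"
      proof -
        have Dv: "(?D *v v) $ a = (\<Sum>l\<in>UNIV. partial_deriv l f 0 * (V l *v v) $ a)" for a
          by (simp add: matrix_vector_mult_def sum_distrib_left sum_distrib_right mult_ac)
             (rule sum.swap)
        show ?thesis
          by (simp add: Dv sum_distrib_left sum_distrib_right mult_ac) (rule sum.swap)
      qed
      then show "cmod (\<Sum>a\<in>UNIV. (?D *v v) $ a * cnj (u $ a))
          \<le> (M\<^sup>2 - (cmod (f 0))\<^sup>2) / M * (norm u * norm v)"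
        using sum_partial_deriv_bound[OF holo sub bound z r] M by (simp add: field_simps)
    qed
    then have "M * op_norm ?D \<le> M\<^sup>2 - (cmod (f 0))\<^sup>2"
      using M by (simp add: field_simps)
    then show "op_norm (rho V f) \<le> M"
      unfolding rho_def by (rule op_norm_scalar_upper_block_le[OF M])
  qed
qed

end
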